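(* Let $0<a<b<\infty$, $0<\alpha<1$, $0\le\beta\le 1$, $\gamma=\alpha+\beta-\alpha\beta$. Let $\varphi:[a,b]\times\mathbb{R}\to\mathbb{R}$ be continuous and satisfy, for some $L>0$, the Lipschitz condition $|\varphi(t,y_1)-\varphi(t,y_2)|\le L|y_1-y_2|$ for all $t$ and all $y_1,y_2\in\mathbb{R}$. Let $x_a\in\mathbb{R}$ and let $\epsilon\in\mathbb{R}$ be an arbitrary constant. Let $x$ be the solution of the initial value problem $${}_{H}D^{\alpha,\beta}_{a+}x(t)=\varphi(t,x(t)),\qquad {}_{H}I^{1-\gamma}_{a+}x(t)\big|_{t=a}=x_a,$$ and let $\tilde{x}$ be the solution of the initial value problem $${}_{H}D^{\alpha,\beta}_{a+}\tilde{x}(t)=\varphi(t,\tilde{x}(t)),\qquad {}_{H}I^{1-\gamma}_{a+}\tilde{x}(t)\big|_{t=a}=x_a+\epsilon.$$ Then $$|\tilde{x}(t)-x(t)|\le|\epsilon|\,\Big(\log\frac{t}{a}\Big)^{\gamma-1}E_{\alpha,\gamma}\!\left[L\Big(\log\frac{t}{a}\Big)^{\alpha}\right],\qquad t\in(a,b],$$ where $E_{\alpha,\gamma}(y)=\sum_{i=0}^{\infty}\frac{y^{i}}{\Gamma(i\alpha+\gamma)}$ is the Mittag-Leffler function.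
   Context: $\log$ is the natural logarithm. Hadamard fractional integral of order $\sigma>0$: ${}_{H}I^{\sigma}_{a+}\varphi(t)=\frac{1}{\Gamma(\sigma)}\int_a^t(\log\frac{t}{\tau})^{\sigma-1}\varphi(\tau)\frac{d\tau}{\tau}$, $t>a$; ${}_{H}I^{0}_{a+}$ is the identity. Hilfer-Hadamard derivative of order $\alpha\in(0,1)$ and type $\beta\in[0,1]$: ${}_{H}D^{\alpha,\beta}_{a+}\varphi={}_{H}I^{\beta(1-\alpha)}_{a+}\big(t\frac{d}{dt}\big)\,{}_{H}I^{(1-\alpha)(1-\beta)}_{a+}\varphi$. The notation $(\cdot)|_{t=a}$ denotes the limit as $t\to a^{+}$. Solutions are sought in the space $C_{1-\gamma,\log}[a,b]$ of functions $x:(a,b]\to\mathbb{R}$ such that $(\log(t/a))^{1-\gamma}x(t)$ extends continuously to $[a,b]$. The problem ${}_{H}D^{\alpha,\beta}_{a+}x(t)=\varphi(t,x(t))$, ${}_{H}I^{1-\gamma}_{a+}x(t)|_{t=a}=c$ is regarded as equivalent to the integral equation $x(t)=\frac{c}{\Gamma(\gamma)}(\log\frac{t}{a})^{\gamma-1}+\frac{1}{\Gamma(\alpha)}\int_a^t(\log\frac{t}{\tau})^{\alpha-1}\varphi(\tau,x(\tau))\frac{d\tau}{\tau}$, $t\in(a,b]$, and solutions are understood as solutions of it. *)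

theory Defs
  imports "HOL-Analysis.Analysis"
begin

text \<open>
  Functions on \<open>(a, b]\<close> are represented by total functions on the reals; only their
  values on \<open>(a, b]\<close> are ever used.
\<close>

definition hadamard_integral :: "real \<Rightarrow> real \<Rightarrow> (real \<Rightarrow> real) \<Rightarrow> real \<Rightarrow> real" where
  "hadamard_integral a \<sigma> f t =
     (if \<sigma> = 0 then f t
      else 1 / Gamma \<sigma> * (LBINT \<tau>:{a<..<t}. ln (t / \<tau>) powr (\<sigma> - 1) * f \<tau> / \<tau>))"

definition weighted_log_space :: "real \<Rightarrow> real \<Rightarrow> real \<Rightarrow> (real \<Rightarrow> real) set" where
  "weighted_log_space \<mu> a b =
     {x. \<exists>g. continuous_on {a..b} g \<and> (\<forall>t\<in>{a<..b}. g t = ln (t / a) powr \<mu> * x t)}"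

text \<open>
  A solution of the Hilfer-Hadamard problem of order \<open>\<alpha>\<close> and type \<open>\<beta>\<close> with right-hand side
  \<open>\<phi>\<close> and initial value \<open>c\<close> for the Hadamard integral of order \<open>1 - \<gamma>\<close> at \<open>a\<close>
  is, by convention, a function in the weighted space of exponent \<open>1 - \<gamma>\<close> that solves the
  equivalent Volterra integral equation.  If \<open>\<phi>\<close> is continuous on \<open>[a, b] \<times> \<real>\<close> and
  Lipschitz in its second argument, \<open>0 < a < b\<close>, \<open>0 < \<alpha> < 1\<close> and \<open>0 \<le> \<beta> \<le> 1\<close>, then the
  integrand is Lebesgue integrable for every \<open>x\<close> in that space, so integrability need not be
  demanded separately.
\<close>

definition hilfer_hadamard_solution ::
  "real \<Rightarrow> real \<Rightarrow> real \<Rightarrow> real \<Rightarrow> (real \<Rightarrow> real \<Rightarrow> real) \<Rightarrow> real \<Rightarrow> (real \<Rightarrow> real) \<Rightarrow> bool" where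
  "hilfer_hadamard_solution \<alpha> \<beta> a b \<phi> c x \<longleftrightarrow>
     (let \<gamma> = \<alpha> + \<beta> - \<alpha> * \<beta> in
        x \<in> weighted_log_space (1 - \<gamma>) a b \<and>
        (\<forall>t\<in>{a<..b}. x t = c / Gamma \<gamma> * ln (t / a) powr (\<gamma> - 1)
                            + hadamard_integral a \<alpha> (\<lambda>\<tau>. \<phi> \<tau> (x \<tau>)) t))"

definition mittag_leffler :: "real \<Rightarrow> real \<Rightarrow> real \<Rightarrow> real" where
  "mittag_leffler \<alpha> \<gamma> y = (\<Sum>i. y ^ i / Gamma (real i * \<alpha> + \<gamma>))"

end

theory Submission
  imports Defs "HOL-Real_Asymp.Real_Asymp"
begin

text \<open>
  Put \<open>l = ln (t / a)\<close> and \<open>r\<^sub>i(t) = L\<^sup>i l powr (i\<alpha> + \<gamma> - 1) / \<Gamma>(i\<alpha> + \<gamma>)\<close>.  The substitution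
  \<open>\<tau> = a exp (l u)\<close> turns the Hadamard integral of a power of \<open>l\<close> into a Beta integral, so that
  \<open>L\<close> times the Hadamard integral of order \<open>\<alpha>\<close> maps \<open>r\<^sub>i\<close> to \<open>r\<^sub>i\<^sub>+\<^sub>1\<close>.  The difference \<open>d\<close> of the two
  solutions is at most \<open>M r\<^sub>0\<close> for some \<open>M\<close>, since both lie in the weighted space, and iterating the
  integral inequality gives \<open>d \<le> \<bar>\<epsilon>\<bar> (r\<^sub>0 + \<dots> + r\<^sub>n\<^sub>-\<^sub>1) + M r\<^sub>n\<close>.  Log-convexity of the Gamma function
  makes \<open>\<Sum> r\<^sub>i\<close> converge by the ratio test, and \<open>n \<longlonglongrightarrow> \<infinity>\<close> yields the claim.
\<close>

section \<open>Convergence of the Mittag-Leffler series\<close>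

text \<open>The point s + 1 is the convex combination of s + \<alpha> and s + \<alpha> + 1 with
  weights \<alpha> and 1 - \<alpha>. Log-convexity there, followed by the functional equation at
  both s + \<alpha> and s, gives the estimate. It bounds the quotient of Gamma at s and at s +
  \<alpha>, which governs the ratio of consecutive Mittag-Leffler terms.\<close>

lemma Gamma_real_add_ge:
  fixes s \<alpha> :: real
  assumes "0 < s" "0 < \<alpha>" "\<alpha> < 1"
  shows "s * Gamma s \<le> Gamma (s + \<alpha>) * (s + \<alpha>) powr (1 - \<alpha>)"
proof -
  have pos: "Gamma s > 0" "Gamma (s + \<alpha>) > 0" "Gamma (s + 1) > 0" "Gamma (s + \<alpha> + 1) > 0"
    using assms by (auto intro!: Gamma_real_pos)
  have G1: "Gamma (z + 1) = z * Gamma z" if "z > 0" for z :: real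
    using Gamma_plus1[of z] that by force
  have "(ln \<circ> Gamma) ((1 - (1 - \<alpha>)) *\<^sub>R (s + \<alpha>) + (1 - \<alpha>) *\<^sub>R (s + \<alpha> + 1))
      \<le> (1 - (1 - \<alpha>)) * (ln \<circ> Gamma) (s + \<alpha>) + (1 - \<alpha>) * (ln \<circ> Gamma) (s + \<alpha> + 1)"
    by (rule convex_onD[OF log_convex_Gamma_real]) (use assms in auto)
  also have "(1 - (1 - \<alpha>)) *\<^sub>R (s + \<alpha>) + (1 - \<alpha>) *\<^sub>R (s + \<alpha> + 1) = s + 1"
    by (simp add: algebra_simps)
  finally have "ln (Gamma (s + 1)) \<le> \<alpha> * ln (Gamma (s + \<alpha>)) + (1 - \<alpha>) * ln (Gamma (s + \<alpha> + 1))"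
    by simp
  also have "ln (Gamma (s + \<alpha> + 1)) = ln (s + \<alpha>) + ln (Gamma (s + \<alpha>))"
    using assms pos G1[of "s + \<alpha>"] ln_mult_pos[of "s + \<alpha>" "Gamma (s + \<alpha>)"] by simp
  finally have "ln (Gamma (s + 1)) \<le> ln (Gamma (s + \<alpha>)) + (1 - \<alpha>) * ln (s + \<alpha>)"
    by (simp add: algebra_simps)
  also have "\<dots> = ln (Gamma (s + \<alpha>) * (s + \<alpha>) powr (1 - \<alpha>))"
    using assms pos by (subst ln_mult_pos) (auto simp: ln_powr)
  finally have "Gamma (s + 1) \<le> Gamma (s + \<alpha>) * (s + \<alpha>) powr (1 - \<alpha>)"
    using assms pos by simp
  then show ?thesis
    using G1[of s] assms by simp
qed

text \<open>With s = i\<alpha> + \<gamma>, the ratio of consecutive absolute terms is at most |y| (s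
  + \<alpha>)^(1 - \<alpha>) / s. Since 1 - \<alpha> < 1, this tends to 0 as s grows, so it is
  eventually below 1/2 for every fixed y.\<close>

lemma mittag_leffler_summable:
  fixes \<alpha> \<gamma> y :: real
  assumes "0 < \<alpha>" "\<alpha> < 1" "0 < \<gamma>"
  shows "summable (\<lambda>i. y ^ i / Gamma (real i * \<alpha> + \<gamma>))"
proof -
  have "((\<lambda>s. \<bar>y\<bar> * ((s + \<alpha>) powr (1 - \<alpha>) / s)) \<longlongrightarrow> 0) at_top"
    using assms by real_asymp
  moreover have "filterlim (\<lambda>i. real i * \<alpha> + \<gamma>) at_top sequentially"
    using assms by real_asymp
  ultimately have "(\<lambda>i. \<bar>y\<bar> * ((real i * \<alpha> + \<gamma> + \<alpha>) powr (1 - \<alpha>) / (real i * \<alpha> + \<gamma>))) \<longlonglongrightarrow> 0"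
    by (rule filterlim_compose)
  then have "\<forall>\<^sub>F i in sequentially.
      \<bar>y\<bar> * ((real i * \<alpha> + \<gamma> + \<alpha>) powr (1 - \<alpha>) / (real i * \<alpha> + \<gamma>)) < 1 / 2"
    by (rule order_tendstoD) simp
  then obtain N where N: "\<And>i. i \<ge> N \<Longrightarrow>
      \<bar>y\<bar> * ((real i * \<alpha> + \<gamma> + \<alpha>) powr (1 - \<alpha>) / (real i * \<alpha> + \<gamma>)) < 1 / 2"
    unfolding eventually_sequentially by blast
  show ?thesis
  proof (rule summable_ratio_test[where c = "1 / 2" and N = N])
    fix i assume "i \<ge> N"
    define s where "s = real i * \<alpha> + \<gamma>"
    have s: "0 < s" "real (Suc i) * \<alpha> + \<gamma> = s + \<alpha>"
      using assms by (auto simp: s_def distrib_right intro!: add_nonneg_pos)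
    have pos: "Gamma s > 0" "Gamma (s + \<alpha>) > 0"
      using assms s by (auto intro!: Gamma_real_pos)
    have "1 / Gamma (s + \<alpha>) \<le> (s + \<alpha>) powr (1 - \<alpha>) / s * (1 / Gamma s)"
      using Gamma_real_add_ge[OF s(1) assms(1,2)] pos s by (simp add: field_simps)
    then have "\<bar>y\<bar> * \<bar>y\<bar> ^ i * (1 / Gamma (s + \<alpha>))
        \<le> \<bar>y\<bar> * \<bar>y\<bar> ^ i * ((s + \<alpha>) powr (1 - \<alpha>) / s * (1 / Gamma s))"
      by (intro mult_left_mono) auto
    also have "\<dots> = (\<bar>y\<bar> * ((s + \<alpha>) powr (1 - \<alpha>) / s)) * (\<bar>y\<bar> ^ i / Gamma s)"
      by simp
    also have "\<dots> \<le> 1 / 2 * (\<bar>y\<bar> ^ i / Gamma s)"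
      using N[OF \<open>i \<ge> N\<close>] pos unfolding s_def by (intro mult_right_mono) auto
    finally show "norm (y ^ Suc i / Gamma (real (Suc i) * \<alpha> + \<gamma>))
        \<le> 1 / 2 * norm (y ^ i / Gamma (real i * \<alpha> + \<gamma>))"
      using pos unfolding s(2) s_def[symmetric] by (simp add: abs_mult power_abs)
  qed simp
qed

section \<open>Hadamard integrals\<close>

text \<open>The integrand is nonnegative, so substituting in the nonnegative integral yields
  integrability and the value at once, even when either power is singular at its endpoint.\<close>

lemma hadamard_kernel_powr_integral:
  fixes a t \<alpha> s :: real
  assumes "0 < a" "a < t" "0 < \<alpha>" "0 < s"
  shows "has_bochner_integral lborel
    (\<lambda>\<tau>. indicator {a<..<t} \<tau> *\<^sub>R (ln (t / \<tau>) powr (\<alpha> - 1) * ln (\<tau> / a) powr (s - 1) / \<tau>))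
    (Beta s \<alpha> * ln (t / a) powr (s + \<alpha> - 1))"
proof -
  define l where "l = ln (t / a)"
  have l: "l > 0" using assms by (simp add: l_def)
  define F where "F = (\<lambda>\<tau>. ln (t / \<tau>) powr (\<alpha> - 1) * ln (\<tau> / a) powr (s - 1) / \<tau>)"
  define g where "g = (\<lambda>u. a * exp (l * u))"
  have F_meas [measurable]: "F \<in> borel_measurable borel" unfolding F_def by measurable
  have g: "g 0 = a" "g 1 = t" using assms by (auto simp: g_def l_def)
  text \<open>Closing the interval changes nothing even pointwise, because \<open>0 powr z = 0\<close>.\<close>
  have closed: "indicator {a<..<t} \<tau> *\<^sub>R F \<tau> = F \<tau> * indicator {a..t} \<tau>" for \<tau>
    using assms by (auto simp: F_def indicator_def)
  have nonneg: "0 \<le> F \<tau> * indicator {a..t} \<tau>" for \<tau>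
    using assms by (auto simp: F_def indicator_def)
  \<comment> \<open>Here \<open>l * g u\<close> is the derivative of \<open>g\<close>. Its factor
    \<open>g u\<close> cancels the division by \<tau> in \<open>F\<close>, and its factor
    \<open>l\<close> joins the two powers of \<open>l\<close> to make the exponent s + \<alpha> -
    1.\<close>
  have subst: "F (g u) * (l * g u) = l powr (s + \<alpha> - 1) * (u powr (s - 1) * (1 - u) powr (\<alpha> - 1))"
    if "u \<in> {0..1}" for u
  proof -
    have "t / g u = exp (l * (1 - u))"
      using assms by (simp add: g_def l_def right_diff_distrib exp_diff)
    then have "ln (t / g u) = l * (1 - u)" "ln (g u / a) = l * u" "g u > 0"
      using assms by (simp_all add: g_def)
    then have "F (g u) * (l * g u) = (l * (1 - u)) powr (\<alpha> - 1) * (l * u) powr (s - 1) * l powr 1"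
      using l by (simp add: F_def)
    also have "\<dots> = (l powr (\<alpha> - 1) * l powr (s - 1) * l powr 1)
        * (u powr (s - 1) * (1 - u) powr (\<alpha> - 1))"
      using l that by (simp add: powr_mult mult_ac)
    also have "l powr (\<alpha> - 1) * l powr (s - 1) * l powr 1 = l powr (s + \<alpha> - 1)"
      unfolding powr_add[symmetric] by (simp add: algebra_simps)
    finally show ?thesis .
  qed
  have "(\<integral>\<^sup>+\<tau>. F \<tau> * indicator {a..t} \<tau> \<partial>lborel) = (\<integral>\<^sup>+\<tau>. F \<tau> * indicator {g 0..g 1} \<tau> \<partial>lborel)"
    by (simp add: g)
  also have "\<dots> = (\<integral>\<^sup>+u. F (g u) * (l * g u) * indicator {0..1} u \<partial>lborel)"
  proof (rule nn_integral_substitution)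
    show "(g has_real_derivative l * g u) (at u)" for u
      unfolding g_def by (auto intro!: derivative_eq_intros)
    show "continuous_on {0..1} (\<lambda>u. l * g u)"
      unfolding g_def by (intro continuous_intros)
    show "0 \<le> l * g u" for u using l assms by (simp add: g_def)
  qed (auto simp: set_borel_measurable_def)
  also have "\<dots> = (\<integral>\<^sup>+u. ennreal (l powr (s + \<alpha> - 1) * (u powr (s - 1) * (1 - u) powr (\<alpha> - 1)))
      * indicator {0..1} u \<partial>lborel)"
    by (intro nn_integral_cong) (auto simp: subst indicator_def)
  also have "\<dots> = ennreal (l powr (s + \<alpha> - 1) * Beta s \<alpha>)"
    using assms by (intro nn_integral_has_integral_lebesgue' has_integral_mult_right
        has_integral_Beta_real) auto
  finally have "has_bochner_integral lborel (\<lambda>\<tau>. F \<tau> * indicator {a..t} \<tau>) (l powr (s + \<alpha> - 1) * Beta s \<alpha>)"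
    using nonneg assms
    by (intro has_bochner_integral_nn_integral) (auto simp: Beta_def Gamma_real_pos less_imp_le)
  then show ?thesis
    unfolding closed[symmetric] by (simp add: F_def l_def mult.commute)
qed

text \<open>
  Only the difference of the two integrands has to be integrable: if one of them is not, then
  neither is the other, and both Bochner integrals are \<open>0\<close>.
\<close>
lemma set_integral_diff_abs_le:
  fixes f g h :: "'a \<Rightarrow> real"
  assumes "set_borel_measurable M A (\<lambda>x. f x - g x)"
    and "has_bochner_integral M (\<lambda>x. indicator A x *\<^sub>R h x) v"
    and "\<And>x. x \<in> A \<Longrightarrow> \<bar>f x - g x\<bar> \<le> h x"
  shows "\<bar>(LINT x:A|M. f x) - (LINT x:A|M. g x)\<bar> \<le> v"
proof -
  let ?F = "\<lambda>x. indicator A x *\<^sub>R f x" and ?G = "\<lambda>x. indicator A x *\<^sub>R g x"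
    and ?H = "\<lambda>x. indicator A x *\<^sub>R h x"
  have H: "integrable M ?H" "integral\<^sup>L M ?H = v"
    using assms(2) by (auto simp: has_bochner_integral_iff)
  have le: "\<bar>?F x - ?G x\<bar> \<le> ?H x" for x
    using assms(3) by (auto simp: indicator_def)
  have meas: "(\<lambda>x. ?F x - ?G x) \<in> borel_measurable M"
    using assms(1) by (simp add: set_borel_measurable_def right_diff_distrib)
  have D: "integrable M (\<lambda>x. ?F x - ?G x)"
    by (rule Bochner_Integration.integrable_bound[OF H(1) meas]) (use le in \<open>auto intro!: AE_I2 order_trans[OF _ abs_ge_self]\<close>)
  have bound: "\<bar>integral\<^sup>L M (\<lambda>x. ?F x - ?G x)\<bar> \<le> v"
    using integral_abs_bound[of M "\<lambda>x. ?F x - ?G x"]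
      integral_mono[OF integrable_abs[OF D] H(1) le] H(2) by linarith
  show ?thesis
  proof (cases "integrable M ?G")
    case True
    with D have "integrable M ?F"
      using Bochner_Integration.integrable_add[OF D True] by simp
    with True bound show ?thesis
      by (simp add: set_lebesgue_integral_def)
  next
    case False
    with D have "\<not> integrable M ?F"
      using Bochner_Integration.integrable_diff[of M ?F "\<lambda>x. ?F x - ?G x"] by auto
    with False bound show ?thesis
      by (simp add: set_lebesgue_integral_def not_integrable_integral_eq)
  qed
qed

text \<open>The difference of the two integrands is dominated by the kernel times \<open>h\<close>,
  whose integral is \<open>v\<close>; continuity enters through measurability. All conditions on
  \<open>f\<close> and \<open>g\<close> concern the open interval, since solutions may be unbounded
  near \<open>a\<close>.\<close>

lemma hadamard_integral_diff_le:
  fixes a t \<alpha> v :: real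
  assumes "0 < a" "0 < \<alpha>"
    and cont: "continuous_on {a<..<t} f" "continuous_on {a<..<t} g"
    and int: "has_bochner_integral lborel
      (\<lambda>\<tau>. indicator {a<..<t} \<tau> *\<^sub>R (ln (t / \<tau>) powr (\<alpha> - 1) * h \<tau> / \<tau>)) v"
    and le: "\<And>\<tau>. \<tau> \<in> {a<..<t} \<Longrightarrow> \<bar>f \<tau> - g \<tau>\<bar> \<le> h \<tau>"
  shows "\<bar>hadamard_integral a \<alpha> f t - hadamard_integral a \<alpha> g t\<bar> \<le> v / Gamma \<alpha>"
proof -
  let ?k = "\<lambda>f \<tau>. ln (t / \<tau>) powr (\<alpha> - 1) * f \<tau> / \<tau>"
  have "\<bar>(LBINT \<tau>:{a<..<t}. ?k f \<tau>) - (LBINT \<tau>:{a<..<t}. ?k g \<tau>)\<bar> \<le> v"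
  proof (rule set_integral_diff_abs_le[OF _ int])
    have "continuous_on {a<..<t} (\<lambda>\<tau>. ?k f \<tau> - ?k g \<tau>)"
      using assms(1) by (intro continuous_intros cont) auto
    then show "set_borel_measurable lborel {a<..<t} (\<lambda>\<tau>. ?k f \<tau> - ?k g \<tau>)"
      unfolding set_borel_measurable_def
      by (subst measurable_lborel2) (rule borel_measurable_continuous_on_indicator, simp_all)
    fix \<tau> assume \<tau>: "\<tau> \<in> {a<..<t}"
    have "\<bar>?k f \<tau> - ?k g \<tau>\<bar> = \<bar>ln (t / \<tau>) powr (\<alpha> - 1) / \<tau> * (f \<tau> - g \<tau>)\<bar>"
      by (simp add: field_simps diff_divide_distrib)
    also have "\<dots> = ln (t / \<tau>) powr (\<alpha> - 1) / \<tau> * \<bar>f \<tau> - g \<tau>\<bar>"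
      using \<tau> assms(1) by (simp add: abs_mult)
    also have "\<dots> \<le> ln (t / \<tau>) powr (\<alpha> - 1) / \<tau> * h \<tau>"
      using \<tau> assms(1) by (intro mult_left_mono le) auto
    finally show "\<bar>?k f \<tau> - ?k g \<tau>\<bar> \<le> ?k h \<tau>" by simp
  qed
  moreover have "Gamma \<alpha> > 0" using assms by (simp add: Gamma_real_pos)
  ultimately show ?thesis
    using assms by (simp add: hadamard_integral_def flip: diff_divide_distrib)
      (simp add: divide_right_mono)
qed

text \<open>The weight is continuous and positive on (a, b], so it can be divided out of the
  continuous extension.\<close>

lemma weighted_log_space_continuous_on:
  assumes "x \<in> weighted_log_space \<mu> a b" "0 < a"
  shows "continuous_on {a<..b} x"
proof -
  from assms(1) obtain g where g: "continuous_on {a..b} g"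
    and eq: "\<And>t. t \<in> {a<..b} \<Longrightarrow> g t = ln (t / a) powr \<mu> * x t"
    unfolding weighted_log_space_def by blast
  have "continuous_on {a<..b} (\<lambda>t. g t / ln (t / a) powr \<mu>)"
    using assms(2) by (intro continuous_intros continuous_on_subset[OF g]) auto
  then show ?thesis
    using assms(2) by (subst continuous_on_cong[OF refl, of _ _ "\<lambda>t. g t / ln (t / a) powr \<mu>"])
      (auto simp: eq)
qed

text \<open>The two continuous extensions live on the compact interval [a, b], so their difference
  is bounded there. Dividing by the weight gives the crude estimate from which the iteration
  starts.\<close>

lemma weighted_log_space_diff_bound:
  assumes "x \<in> weighted_log_space \<mu> a b" "y \<in> weighted_log_space \<mu> a b" "0 < a"
  obtains M where "0 \<le> M" "\<And>t. t \<in> {a<..b} \<Longrightarrow> \<bar>y t - x t\<bar> \<le> M * ln (t / a) powr (- \<mu>)"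
proof -
  from assms(1) obtain g where g: "continuous_on {a..b} g"
    and eq: "\<And>t. t \<in> {a<..b} \<Longrightarrow> g t = ln (t / a) powr \<mu> * x t"
    unfolding weighted_log_space_def by blast
  from assms(2) obtain h where h: "continuous_on {a..b} h"
    and eq': "\<And>t. t \<in> {a<..b} \<Longrightarrow> h t = ln (t / a) powr \<mu> * y t"
    unfolding weighted_log_space_def by blast
  have "bounded ((\<lambda>t. h t - g t) ` {a..b})"
    by (intro compact_imp_bounded compact_continuous_image continuous_intros g h compact_Icc)
  then obtain M where "M > 0" and M: "\<And>t. t \<in> {a..b} \<Longrightarrow> \<bar>h t - g t\<bar> \<le> M"
    unfolding bounded_pos by auto
  show ?thesis
  proof (rule that)
    fix t assume t: "t \<in> {a<..b}"
    then have "\<bar>ln (t / a) powr \<mu> * (y t - x t)\<bar> \<le> M"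
      using M[of t] eq[OF t] eq'[OF t] by (simp add: right_diff_distrib)
    moreover have "ln (t / a) powr \<mu> > 0" using t assms(3) by simp
    ultimately show "\<bar>y t - x t\<bar> \<le> M * ln (t / a) powr (- \<mu>)"
      by (simp add: abs_mult powr_minus pos_le_divide_eq mult.commute flip: divide_inverse)
  qed (use \<open>M > 0\<close> in simp)
qed

section \<open>Dependence on the initial value\<close>

theorem theorem3p2p4:
  fixes a b \<alpha> \<beta> \<gamma> L x\<^sub>a \<epsilon> :: real
    and \<phi> :: "real \<Rightarrow> real \<Rightarrow> real"
    and x x' :: "real \<Rightarrow> real"
  assumes "0 < a" and "a < b"
    and "0 < \<alpha>" and "\<alpha> < 1"
    and "0 \<le> \<beta>" and "\<beta> \<le> 1"
    and "\<gamma> = \<alpha> + \<beta> - \<alpha> * \<beta>"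
    and "continuous_on ({a..b} \<times> UNIV) (\<lambda>(t, y). \<phi> t y)"
    and "0 < L"
    and "\<And>t y\<^sub>1 y\<^sub>2. t \<in> {a..b} \<Longrightarrow> \<bar>\<phi> t y\<^sub>1 - \<phi> t y\<^sub>2\<bar> \<le> L * \<bar>y\<^sub>1 - y\<^sub>2\<bar>"
    and "hilfer_hadamard_solution \<alpha> \<beta> a b \<phi> x\<^sub>a x"
    and "hilfer_hadamard_solution \<alpha> \<beta> a b \<phi> (x\<^sub>a + \<epsilon>) x'"
  shows "\<forall>t\<in>{a<..b}. \<bar>x' t - x t\<bar>
           \<le> \<bar>\<epsilon>\<bar> * ln (t / a) powr (\<gamma> - 1) * mittag_leffler \<alpha> \<gamma> (L * ln (t / a) powr \<alpha>)"
proof -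
  \<comment> \<open>Positivity of \<gamma> comes from \<gamma> = \<alpha> + \<beta> (1 - \<alpha>)
    \<ge> \<alpha>.\<close>
  have "0 \<le> \<beta> * (1 - \<alpha>)" using assms(4,5) by simp
  with assms(3,7) have \<gamma>: "0 < \<gamma>" by (simp add: algebra_simps)
  have x: "x \<in> weighted_log_space (1 - \<gamma>) a b"
    and x_eq: "\<And>t. t \<in> {a<..b} \<Longrightarrow> x t = x\<^sub>a / Gamma \<gamma> * ln (t / a) powr (\<gamma> - 1)
      + hadamard_integral a \<alpha> (\<lambda>\<tau>. \<phi> \<tau> (x \<tau>)) t"
    using assms(11) unfolding hilfer_hadamard_solution_def Let_def assms(7)[symmetric] by auto
  have x': "x' \<in> weighted_log_space (1 - \<gamma>) a b"
    and x'_eq: "\<And>t. t \<in> {a<..b} \<Longrightarrow> x' t = (x\<^sub>a + \<epsilon>) / Gamma \<gamma> * ln (t / a) powr (\<gamma> - 1)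
      + hadamard_integral a \<alpha> (\<lambda>\<tau>. \<phi> \<tau> (x' \<tau>)) t"
    using assms(12) unfolding hilfer_hadamard_solution_def Let_def assms(7)[symmetric] by auto
  have cont: "continuous_on {a<..<t} (\<lambda>\<tau>. \<phi> \<tau> (y \<tau>))"
    if "y \<in> weighted_log_space (1 - \<gamma>) a b" "t \<le> b" for y t
  proof -
    have "continuous_on {a<..<t} (\<lambda>\<tau>. (\<tau>, y \<tau>))"
      using that(2) by (intro continuous_intros
          continuous_on_subset[OF weighted_log_space_continuous_on[OF that(1) assms(1)]]) auto
    then have "continuous_on {a<..<t} (\<lambda>\<tau>. case (\<tau>, y \<tau>) of (t, y) \<Rightarrow> \<phi> t y)"
      using that(2) by (intro continuous_on_compose2[OF assms(8)]) auto
    then show ?thesis by simp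
  qed
  define r where "r = (\<lambda>i t. L ^ i * ln (t / a) powr (real i * \<alpha> + \<gamma> - 1) / Gamma (real i * \<alpha> + \<gamma>))"
  have G: "0 < real i * \<alpha> + \<gamma>" "0 < Gamma (real i * \<alpha> + \<gamma>)" for i
    using assms(3) \<gamma> by (auto intro!: Gamma_real_pos add_nonneg_pos)
  have G\<alpha>: "Gamma \<alpha> > 0" using assms(3) by (rule Gamma_real_pos)
  \<comment> \<open>Writing Beta as a quotient of Gamma values, the Gamma of s cancels the
    denominator of \<open>r i\<close> and the Gamma of s + \<alpha> becomes that of
    \<open>r (Suc i)\<close>. The remaining \<open>Gamma \<alpha>\<close> is later absorbed by the
    prefactor of the Hadamard integral.\<close>
  have r_int: "has_bochner_integral lborel
      (\<lambda>\<tau>. indicator {a<..<t} \<tau> *\<^sub>R (ln (t / \<tau>) powr (\<alpha> - 1) * (L * r i \<tau>) / \<tau>))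
      (Gamma \<alpha> * r (Suc i) t)" if "a < t" for t i
  proof -
    define s where "s = real i * \<alpha> + \<gamma>"
    have s: "real (Suc i) * \<alpha> + \<gamma> = s + \<alpha>" "s > 0" "Gamma s > 0"
      using G[of i] by (auto simp: s_def algebra_simps)
    have "has_bochner_integral lborel
      (\<lambda>\<tau>. L ^ Suc i / Gamma s * (indicator {a<..<t} \<tau> *\<^sub>R
        (ln (t / \<tau>) powr (\<alpha> - 1) * ln (\<tau> / a) powr (s - 1) / \<tau>)))
      (L ^ Suc i / Gamma s * (Beta s \<alpha> * ln (t / a) powr (s + \<alpha> - 1)))"
      using assms that s
      by (intro has_bochner_integral_mult_right hadamard_kernel_powr_integral) auto
    also have "(\<lambda>\<tau>. L ^ Suc i / Gamma s * (indicator {a<..<t} \<tau> *\<^sub>R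
        (ln (t / \<tau>) powr (\<alpha> - 1) * ln (\<tau> / a) powr (s - 1) / \<tau>)))
      = (\<lambda>\<tau>. indicator {a<..<t} \<tau> *\<^sub>R (ln (t / \<tau>) powr (\<alpha> - 1) * (L * r i \<tau>) / \<tau>))"
      by (simp add: r_def s_def fun_eq_iff)
    also have "L ^ Suc i / Gamma s * (Beta s \<alpha> * ln (t / a) powr (s + \<alpha> - 1)) = Gamma \<alpha> * r (Suc i) t"
      using s(3) unfolding r_def s(1) Beta_def by simp
    finally show ?thesis .
  qed
  obtain M where "0 \<le> M"
    and M: "\<And>t. t \<in> {a<..b} \<Longrightarrow> \<bar>x' t - x t\<bar> \<le> M * ln (t / a) powr (- (1 - \<gamma>))"
    using weighted_log_space_diff_bound[OF x x' assms(1)] by blast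
  \<comment> \<open>The factor \<open>Gamma \<gamma>\<close> normalizes the crude bound: the power
    of the logarithm with exponent \<gamma> - 1 equals \<open>Gamma \<gamma> * r 0 t\<close>. The
    induction keeps \<open>t\<close> arbitrary because the integral uses the previous bound at every
    point of (a, t).\<close>
  have iterate: "\<bar>x' t - x t\<bar> \<le> \<bar>\<epsilon>\<bar> * (\<Sum>i<n. r i t) + M * Gamma \<gamma> * r n t"
    if "t \<in> {a<..b}" for n t
    using that
  proof (induction n arbitrary: t)
    case 0
    then show ?case using M[of t] G(2)[of 0] by (simp add: r_def)
  next
    case (Suc n)
    let ?B = "\<lambda>\<tau>. \<bar>\<epsilon>\<bar> * (\<Sum>i<n. r i \<tau>) + M * Gamma \<gamma> * r n \<tau>"
    have "has_bochner_integral lborel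
      (\<lambda>\<tau>. \<bar>\<epsilon>\<bar> * (\<Sum>i<n. indicator {a<..<t} \<tau> *\<^sub>R (ln (t / \<tau>) powr (\<alpha> - 1) * (L * r i \<tau>) / \<tau>))
        + M * Gamma \<gamma> * (indicator {a<..<t} \<tau> *\<^sub>R (ln (t / \<tau>) powr (\<alpha> - 1) * (L * r n \<tau>) / \<tau>)))
      (\<bar>\<epsilon>\<bar> * (\<Sum>i<n. Gamma \<alpha> * r (Suc i) t) + M * Gamma \<gamma> * (Gamma \<alpha> * r (Suc n) t))"
      using Suc.prems by (intro has_bochner_integral_add has_bochner_integral_mult_right
          has_bochner_integral_sum r_int) auto
    also have "(\<lambda>\<tau>. \<bar>\<epsilon>\<bar> * (\<Sum>i<n. indicator {a<..<t} \<tau> *\<^sub>R (ln (t / \<tau>) powr (\<alpha> - 1) * (L * r i \<tau>) / \<tau>))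
        + M * Gamma \<gamma> * (indicator {a<..<t} \<tau> *\<^sub>R (ln (t / \<tau>) powr (\<alpha> - 1) * (L * r n \<tau>) / \<tau>)))
      = (\<lambda>\<tau>. indicator {a<..<t} \<tau> *\<^sub>R (ln (t / \<tau>) powr (\<alpha> - 1) * (L * ?B \<tau>) / \<tau>))"
      by (auto simp: fun_eq_iff indicator_def sum_distrib_left sum_distrib_right sum_divide_distrib
          algebra_simps add_divide_distrib)
    finally have "\<bar>hadamard_integral a \<alpha> (\<lambda>\<tau>. \<phi> \<tau> (x' \<tau>)) t - hadamard_integral a \<alpha> (\<lambda>\<tau>. \<phi> \<tau> (x \<tau>)) t\<bar>
      \<le> (\<bar>\<epsilon>\<bar> * (\<Sum>i<n. Gamma \<alpha> * r (Suc i) t) + M * Gamma \<gamma> * (Gamma \<alpha> * r (Suc n) t)) / Gamma \<alpha>"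
    proof (rule hadamard_integral_diff_le[OF assms(1,3) cont[OF x'] cont[OF x], rotated 2])
      fix \<tau> assume \<tau>: "\<tau> \<in> {a<..<t}"
      then have "\<bar>\<phi> \<tau> (x' \<tau>) - \<phi> \<tau> (x \<tau>)\<bar> \<le> L * \<bar>x' \<tau> - x \<tau>\<bar>"
        using Suc.prems by (intro assms(10)) auto
      also have "\<dots> \<le> L * ?B \<tau>"
        using \<tau> Suc.prems assms(9) by (intro mult_left_mono Suc.IH) auto
      finally show "\<bar>\<phi> \<tau> (x' \<tau>) - \<phi> \<tau> (x \<tau>)\<bar> \<le> L * ?B \<tau>" .
    qed (use Suc.prems in auto)
    also have "\<dots> = \<bar>\<epsilon>\<bar> * (\<Sum>i<n. r (Suc i) t) + M * Gamma \<gamma> * r (Suc n) t"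
      using G\<alpha> by (simp add: add_divide_distrib flip: sum_distrib_left)
    finally have H: "\<bar>hadamard_integral a \<alpha> (\<lambda>\<tau>. \<phi> \<tau> (x' \<tau>)) t - hadamard_integral a \<alpha> (\<lambda>\<tau>. \<phi> \<tau> (x \<tau>)) t\<bar>
      \<le> \<bar>\<epsilon>\<bar> * (\<Sum>i<n. r (Suc i) t) + M * Gamma \<gamma> * r (Suc n) t" .
    \<comment> \<open>The free terms of the two integral equations differ by exactly
      \<open>\<epsilon> * r 0 t\<close>. This supplies the index 0 that the shifted sum in
      \<open>H\<close> lacks.\<close>
    have "x' t - x t = \<epsilon> * r 0 t
      + (hadamard_integral a \<alpha> (\<lambda>\<tau>. \<phi> \<tau> (x' \<tau>)) t - hadamard_integral a \<alpha> (\<lambda>\<tau>. \<phi> \<tau> (x \<tau>)) t)"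
      using x_eq[OF Suc.prems] x'_eq[OF Suc.prems]
      by (simp add: r_def add_divide_distrib algebra_simps)
    moreover have "\<bar>\<epsilon> * r 0 t\<bar> = \<bar>\<epsilon>\<bar> * r 0 t"
      using G(2)[of 0] by (simp add: r_def abs_mult)
    ultimately have "\<bar>x' t - x t\<bar> \<le> \<bar>\<epsilon>\<bar> * r 0 t + (\<bar>\<epsilon>\<bar> * (\<Sum>i<n. r (Suc i) t) + M * Gamma \<gamma> * r (Suc n) t)"
      using H by linarith
    then show ?case
      by (simp only: sum.lessThan_Suc_shift distrib_left add.assoc)
  qed
  show ?thesis
  proof
    fix t assume t: "t \<in> {a<..b}"
    define Y where "Y = L * ln (t / a) powr \<alpha>"
    have l: "ln (t / a) > 0" using t assms(1) by simp
    \<comment> \<open>Splitting the exponent into i\<alpha> and \<gamma> - 1 shows that the iterates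
      are the Mittag-Leffler terms at \<open>Y\<close>, times a factor independent of
      \<open>i\<close>.\<close>
    have r_eq: "r i t = ln (t / a) powr (\<gamma> - 1) * (Y ^ i / Gamma (real i * \<alpha> + \<gamma>))" for i
    proof -
      have "ln (t / a) powr (real i * \<alpha> + \<gamma> - 1) = ln (t / a) powr (\<alpha> * real i) * ln (t / a) powr (\<gamma> - 1)"
        by (simp add: algebra_simps flip: powr_add)
      also have "ln (t / a) powr (\<alpha> * real i) = (ln (t / a) powr \<alpha>) ^ i"
        using l by (simp add: powr_realpow flip: powr_powr)
      finally show ?thesis by (simp add: r_def Y_def power_mult_distrib)
    qed
    have sums: "(\<lambda>i. r i t) sums (ln (t / a) powr (\<gamma> - 1) * mittag_leffler \<alpha> \<gamma> Y)"
      unfolding r_eq mittag_leffler_def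
      by (intro sums_mult summable_sums mittag_leffler_summable assms \<gamma>)
    \<comment> \<open>The remainder vanishes in the limit because \<open>r n t\<close> is the
      general term of a convergent series.\<close>
    have "(\<lambda>n. \<bar>\<epsilon>\<bar> * (\<Sum>i<n. r i t) + M * Gamma \<gamma> * r n t)
      \<longlonglongrightarrow> \<bar>\<epsilon>\<bar> * (ln (t / a) powr (\<gamma> - 1) * mittag_leffler \<alpha> \<gamma> Y) + M * Gamma \<gamma> * 0"
      using sums by (intro tendsto_intros summable_LIMSEQ_zero) (auto simp: sums_def summable_def)
    then have "\<bar>x' t - x t\<bar> \<le> \<bar>\<epsilon>\<bar> * (ln (t / a) powr (\<gamma> - 1) * mittag_leffler \<alpha> \<gamma> Y) + M * Gamma \<gamma> * 0"
      using iterate[OF t] by (intro LIMSEQ_le_const) auto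
    then show "\<bar>x' t - x t\<bar>
        \<le> \<bar>\<epsilon>\<bar> * ln (t / a) powr (\<gamma> - 1) * mittag_leffler \<alpha> \<gamma> (L * ln (t / a) powr \<alpha>)"
      by (simp add: Y_def mult.assoc)
  qed
qed

end
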